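(* For any nonnegative integer $m$, there exists a graph $G_m$ on $n$ vertices with $m$ independent edges such that $D_{n-m}(G_m)$ is not connected.
   Context: All graphs are finite, simple and undirected. A set $S\subseteq V(G)$ is a dominating set of $G$ if every vertex of $V(G)\setminus S$ is adjacent to a vertex of $S$. A set of edges is independent if no two share an endpoint. For a positive integer $k$, the $k$-dominating graph $D_k(G)$ has as vertices the dominating sets of $G$ of cardinality at most $k$, two such sets being adjacent iff their symmetric difference consists of exactly one vertex of $G$.
   Formalization: The claim is stated for m ≥ 1 instead of every nonnegative integer m; for m = 0 it is false, since D_n(G) is connected for every graph G on n vertices (every dominating set can be enlarged one vertex at a time to V(G)). *)

theory Defs
  imports "Graph_Theory.Pair_Digraph" "Graph_Theory.Digraph_Component"
begin

text \<open>
  A finite simple undirected graph is a \<^locale>\<open>pair_graph\<close>: a finite loop-free symmetric digraph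
  whose arcs are pairs of vertices. Since each undirected edge is represented there by two
  opposite arcs, edges are identified with their two-element sets of endpoints.
\<close>

definition uedges :: "'a pair_pre_digraph \<Rightarrow> 'a set set" where
  "uedges G = {{u, v} | u v. (u, v) \<in> parcs G}"

definition independent_edges :: "'a set set \<Rightarrow> bool" where
  "independent_edges M \<longleftrightarrow> pairwise disjnt M"

definition dominating_set :: "'a pair_pre_digraph \<Rightarrow> 'a set \<Rightarrow> bool" where
  "dominating_set G S \<longleftrightarrow>
     S \<subseteq> pverts G \<and> (\<forall>v \<in> pverts G - S. \<exists>u \<in> S. (v, u) \<in> parcs G)"

definition dominating_graph :: "nat \<Rightarrow> 'a pair_pre_digraph \<Rightarrow> 'a set pair_pre_digraph" where
  "dominating_graph k G =
     (let D = {S. dominating_set G S \<and> card S \<le> k}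
      in \<lparr>pverts = D, parcs = {(A, B). A \<in> D \<and> B \<in> D \<and> card (sym_diff A B) = 1}\<rparr>)"

text \<open>
  If $k$ is the number of vertices of $G$, the $k$-dominating graph of $G$ is connected:
  every dominating set can be enlarged to the whole vertex set, one vertex at a time.
  Hence no graph satisfies the conclusion of the theorem for $m = 0$.
\<close>

lemma connected_dominating_graph_card:
  assumes "finite (pverts G)"
  shows "Digraph_Component.connected (with_proj (dominating_graph (card (pverts G)) G))"
proof -
  let ?V = "pverts G"
  let ?D = "dominating_graph (card ?V) G"
  let ?R = "rtrancl_on (pverts ?D) ((parcs ?D)\<^sup>s)"
  have verts: "S \<in> pverts ?D \<longleftrightarrow> dominating_set G S" for S
    using assms by (auto simp: dominating_graph_def Let_def dominating_set_def intro: card_mono)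
  have top: "?V \<in> pverts ?D"
    by (simp add: verts dominating_set_def)
  have up: "(S, ?V) \<in> ?R" if "S \<in> pverts ?D" for S
    using that
  proof (induction "card (?V - S)" arbitrary: S)
    case 0
    then have "S = ?V"
      using assms by (auto simp: verts dominating_set_def)
    then show ?case using top by simp
  next
    case (Suc n)
    then obtain x where x: "x \<in> ?V - S"
      by (metis card.empty equals0I nat.distinct(1))
    have ins: "insert x S \<in> pverts ?D"
      using Suc.prems x by (auto simp: verts dominating_set_def)
    have "?V - insert x S = (?V - S) - {x}" by auto
    then have "n = card (?V - insert x S)"
      using Suc.hyps(2) x assms by (metis card_Diff_singleton diff_Suc_1)
    then have "(insert x S, ?V) \<in> ?R"
      using Suc.hyps(1) ins by blast
    moreover have "sym_diff S (insert x S) = {x}" using x by auto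
    then have "(S, insert x S) \<in> parcs ?D"
      using Suc.prems ins by (simp add: dominating_graph_def Let_def)
    ultimately show ?case
      using Suc.prems converse_rtrancl_on_into_rtrancl_on
      by (metis UnI1 symcl_def)
  qed
  have "sym ?R"
    by (rule rtrancl_on_sym) (auto simp: sym_def symcl_def)
  then have "(S, T) \<in> ?R" if "S \<in> pverts ?D" "T \<in> pverts ?D" for S T
    using up[OF that(1)] up[OF that(2)] by (meson rtrancl_on_trans symD)
  then show ?thesis
    using top by (auto simp: connected_conv)
qed

end

theory Submission
  imports Defs
begin

text \<open>
  The graph is a perfect matching on $2m$ vertices. A dominating set meets every edge, so it has
  at least $m$ vertices; those of cardinality at most $m = n - m$ therefore all have the same
  cardinality, and the dominating graph has no edges although it has at least two vertices.
\<close>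

definition matching_graph :: "nat \<Rightarrow> nat pair_pre_digraph" where
  "matching_graph m =
     \<lparr>pverts = {..<2 * m},
      parcs = {(u, v). u < 2 * m \<and> v < 2 * m \<and> u \<noteq> v \<and> u div 2 = v div 2}\<rparr>"

lemma matching_graph_simps [simp]:
  "pverts (matching_graph m) = {..<2 * m}"
  "(u, v) \<in> parcs (matching_graph m) \<longleftrightarrow>
     u < 2 * m \<and> v < 2 * m \<and> u \<noteq> v \<and> u div 2 = v div 2"
  by (simp_all add: matching_graph_def)

lemma pair_graph_matching_graph: "pair_graph (matching_graph m)"
proof
  have "parcs (matching_graph m) \<subseteq> {..<2 * m} \<times> {..<2 * m}"
    by auto
  then show "finite (parcs (matching_graph m))"
    by (rule finite_subset) simp
qed (auto simp: symmetric_def sym_def arcs_ends_conv)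

lemma matching_graph_independent_edges:
  "\<exists>M \<subseteq> uedges (matching_graph m). independent_edges M \<and> card M = m"
proof (intro exI conjI)
  let ?e = "\<lambda>i::nat. {2 * i, 2 * i + 1}"
  show "?e ` {..<m} \<subseteq> uedges (matching_graph m)"
  proof safe
    fix i assume "i < m"
    then have "(2 * i, 2 * i + 1) \<in> parcs (matching_graph m)" by simp
    then show "?e i \<in> uedges (matching_graph m)" unfolding uedges_def by blast
  qed
  show "independent_edges (?e ` {..<m})"
    \<comment> \<open>Linear arithmetic with parity: \<open>2 * i\<close> and
      \<open>2 * i + 1\<close> determine \<open>i\<close>, so different pairs share no
      endpoint.\<close>
    unfolding independent_edges_def pairwise_def disjnt_def by auto presburger+
  have "inj ?e"
    by (rule injI) (auto simp: doubleton_eq_iff)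
  then show "card (?e ` {..<m}) = m"
    by (simp add: card_image inj_on_subset)
qed

text \<open>Since \<open>u div 2\<close> is the index of the edge containing \<open>u\<close>, and
  \<open>2 * i\<close> has its only neighbour on edge \<open>i\<close>, \<open>S\<close> must
  contain an endpoint of each edge. Thus \<open>u div 2\<close> maps \<open>S\<close> onto the
  \<open>m\<close> indices.\<close>

lemma dominating_set_matching_graph_card:
  assumes "dominating_set (matching_graph m) S"
  shows "m \<le> card S"
proof -
  have S: "S \<subseteq> {..<2 * m}" and
    dom: "\<And>v. v < 2 * m \<Longrightarrow> v \<notin> S \<Longrightarrow> \<exists>u \<in> S. v div 2 = u div 2"
    using assms by (auto simp: dominating_set_def)
  have "i \<in> (\<lambda>u. u div 2) ` S" if "i < m" for i
    using dom[of "2 * i"] that by (cases "2 * i \<in> S") force+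
  then have "{..<m} \<subseteq> (\<lambda>u. u div 2) ` S" by blast
  moreover have "finite S"
    using S by (rule finite_subset) simp
  ultimately show ?thesis
    using surj_card_le[of S "{..<m}"] by simp
qed

text \<open>Choosing the end of parity \<open>r\<close> on every edge dominates the other end. The
  values 0 and 1 of \<open>r\<close> supply the two vertices to be separated.\<close>

lemma dominating_set_matching_graph_transversal:
  assumes "r < 2"
  shows "dominating_set (matching_graph m) ((\<lambda>i. 2 * i + r) ` {..<m})"
  unfolding dominating_set_def
proof (intro conjI ballI)
  show "(\<lambda>i. 2 * i + r) ` {..<m} \<subseteq> pverts (matching_graph m)"
    using assms by auto
  fix v assume v: "v \<in> pverts (matching_graph m) - (\<lambda>i. 2 * i + r) ` {..<m}"
  then have "v div 2 < m" by auto
  \<comment> \<open>The dominating neighbour is the chosen end of the edge containing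
    \<open>v\<close>; it differs from \<open>v\<close> because \<open>v\<close> is not
    chosen.\<close>
  then have "2 * (v div 2) + r \<in> (\<lambda>i. 2 * i + r) ` {..<m}" by blast
  moreover from this have "(v, 2 * (v div 2) + r) \<in> parcs (matching_graph m)"
    using v assms \<open>v div 2 < m\<close> by auto
  ultimately show "\<exists>u \<in> (\<lambda>i. 2 * i + r) ` {..<m}. (v, u) \<in> parcs (matching_graph m)"
    by blast
qed

text \<open>Equal cardinalities force \<open>A - B\<close> and \<open>B - A\<close> to have the same
  size, and these two disjoint sets make up the symmetric difference.\<close>

lemma even_card_sym_diff:
  assumes "finite A" "finite B" "card A = card B"
  shows "even (card (sym_diff A B))"
proof -
  have "card (sym_diff A B) = card (A - B) + card (B - A)"
    using assms by (intro card_Un_disjoint) auto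
  also have "card (A - B) = card (B - A)"
    using assms card_le_sym_Diff[of A B] card_le_sym_Diff[of B A] by simp
  finally show ?thesis by simp
qed

text \<open>The lower bound \<open>m\<close> meets the cap \<open>m\<close>, so all vertices are
  sets of size exactly \<open>m\<close>; by parity no two of them differ in a single
  element.\<close>

lemma parcs_dominating_graph_matching_graph:
  "parcs (dominating_graph m (matching_graph m)) = {}"
proof -
  have "card (sym_diff A B) \<noteq> 1"
    if A: "dominating_set (matching_graph m) A" "card A \<le> m"
      and B: "dominating_set (matching_graph m) B" "card B \<le> m" for A B
  proof -
    have "finite A" "finite B"
      using A B by (auto simp: dominating_set_def intro: finite_subset)
    moreover have "card A = card B"
      using A B dominating_set_matching_graph_card by (metis le_antisym)
    ultimately show ?thesis
      using even_card_sym_diff by fastforce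
  qed
  then show ?thesis by (auto simp: dominating_graph_def Let_def)
qed

text \<open>Connectedness is reachability along the symmetric closure of the arcs. With no arcs this
  closure is empty, and a vertex reaches only itself.\<close>

lemma not_connected_if_no_arcs:
  assumes "parcs G = {}" "u \<in> pverts G" "v \<in> pverts G" "u \<noteq> v"
  shows "\<not> Digraph_Component.connected (with_proj G)"
proof
  assume "Digraph_Component.connected (with_proj G)"
  then have "(u, v) \<in> rtrancl_on (pverts G) ((parcs G)\<^sup>s)"
    using assms by (simp add: connected_conv)
  then show False
    using assms by (cases rule: rtrancl_on.cases) (auto simp: symcl_def)
qed

theorem theorem2:
  fixes m :: nat
  assumes "m \<ge> 1"
  shows "\<exists>G :: nat pair_pre_digraph.
           pair_graph G \<and>
           (\<exists>M \<subseteq> uedges G. independent_edges M \<and> card M = m) \<and>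
           \<not> Digraph_Component.connected
               (with_proj (dominating_graph (card (pverts G) - m) G))"
proof (rule exI, intro conjI)
  let ?G = "matching_graph m"
  let ?T = "\<lambda>r. (\<lambda>i. 2 * i + r) ` {..<m}"
  show "pair_graph ?G"
    by (rule pair_graph_matching_graph)
  show "\<exists>M \<subseteq> uedges ?G. independent_edges M \<and> card M = m"
    by (rule matching_graph_independent_edges)
  have T: "?T r \<in> pverts (dominating_graph m ?G)" if "r < 2" for r
    using dominating_set_matching_graph_transversal[OF that] card_image_le[of "{..<m}"]
    by (simp add: dominating_graph_def Let_def)
  \<comment> \<open>Here \<open>m \<ge> 1\<close> enters: the index 0 exists and puts 0 into
    \<open>?T 0\<close>, whereas \<open>?T 1\<close> has only odd elements. For \<open>m = 0\<close>
    both sets would be empty.\<close>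
  have "0 \<in> ?T 0" "0 \<notin> ?T 1"
    using assms by (auto simp: image_iff intro: bexI[of _ 0])
  then have "?T 0 \<noteq> ?T 1" by metis
  then have "\<not> Digraph_Component.connected (with_proj (dominating_graph m ?G))"
    using not_connected_if_no_arcs[OF parcs_dominating_graph_matching_graph T[of 0] T[of 1]]
    by simp
  moreover have "card (pverts ?G) - m = m" by simp
  ultimately show "\<not> Digraph_Component.connected
      (with_proj (dominating_graph (card (pverts ?G) - m) ?G))"
    by simp
qed

end
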